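(* For every prime $p$, the endomorphism monoid of the JK-group $G_{(1,0)}^{(p)}$ is not commutative. The endomorphism monoid of $G_{(1,1)}^{(2)}$ is not commutative either. In particular, end-commutativity is a strictly stronger group property than aut-abelianity: every end-commutative group is aut-abelian, but there exist aut-abelian groups that are not end-commutative.
   Context: A group is called aut-abelian if its automorphism group is abelian, and end-commutative if its endomorphism monoid (all endomorphisms under composition) is commutative. For a prime $p$ and $\lambda=(\lambda_1,\lambda_2)\in\{(1,0),(0,1),(1,1),\ldots,(p-1,1)\}$, the JK-group $G_{\lambda}^{(p)}$ is the group generated by $a_1,a_2,b_1,b_2$ subject to the relations stating that it is nilpotent of class (at most) $2$ (all commutators are central) together with $$a_1^p=[a_1,b_1],\quad a_2^p=[a_1,b_1^{\lambda_1}b_2^{\lambda_2}],\quad b_1^p=[a_2,b_1b_2],\quad b_2^p=[a_2,b_2],\quad [a_1,a_2]=[b_1,b_2]=1.$$ It is a $p$-group of order $p^8$. It is a known result of Jonah and Konvisser (1975) that all JK-groups are aut-abelian. *)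

theory Defs
  imports "HOL-Algebra.Bij" "HOL-Computational_Algebra.Primes"
begin

section \<open>Commutativity of automorphism groups and endomorphism monoids\<close>

text \<open>As for \<^const>\<open>AutoGroup\<close>, the underlying maps are taken extensional, so that two
  endomorphisms are equal iff they agree on the carrier.\<close>

definition EndMonoid :: "('a, 'b) monoid_scheme \<Rightarrow> ('a \<Rightarrow> 'a) monoid" where
  "EndMonoid G =
    \<lparr>carrier = hom G G \<inter> extensional (carrier G),
     monoid.mult = (\<lambda>f g. compose (carrier G) f g),
     one = (\<lambda>x\<in>carrier G. x)\<rparr>"

definition aut_abelian :: "('a, 'b) monoid_scheme \<Rightarrow> bool" where
  "aut_abelian G \<longleftrightarrow> comm_group (AutoGroup G)"

definition end_commutative :: "('a, 'b) monoid_scheme \<Rightarrow> bool" where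
  "end_commutative G \<longleftrightarrow> comm_monoid (EndMonoid G)"

lemma monoid_EndMonoid:
  assumes "group G"
  shows "monoid (EndMonoid G)"
proof (rule monoidI)
  fix f g assume "f \<in> carrier (EndMonoid G)" "g \<in> carrier (EndMonoid G)"
  then show "f \<otimes>\<^bsub>EndMonoid G\<^esub> g \<in> carrier (EndMonoid G)"
    using group.is_monoid[OF assms]
    by (auto simp: EndMonoid_def hom_def compose_def extensional_def Pi_iff monoid.m_closed)
next
  show "\<one>\<^bsub>EndMonoid G\<^esub> \<in> carrier (EndMonoid G)"
    using group.is_monoid[OF assms]
    by (auto simp: EndMonoid_def hom_def monoid.m_closed)
next
  fix f g h
  assume "f \<in> carrier (EndMonoid G)" "g \<in> carrier (EndMonoid G)" "h \<in> carrier (EndMonoid G)"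
  then show "f \<otimes>\<^bsub>EndMonoid G\<^esub> g \<otimes>\<^bsub>EndMonoid G\<^esub> h
      = f \<otimes>\<^bsub>EndMonoid G\<^esub> (g \<otimes>\<^bsub>EndMonoid G\<^esub> h)"
    by (auto simp: EndMonoid_def hom_def compose_def fun_eq_iff Pi_iff)
next
  fix f assume "f \<in> carrier (EndMonoid G)"
  then show "\<one>\<^bsub>EndMonoid G\<^esub> \<otimes>\<^bsub>EndMonoid G\<^esub> f = f"
    by (auto simp: EndMonoid_def hom_def compose_def fun_eq_iff Pi_iff extensional_def)
next
  fix f assume "f \<in> carrier (EndMonoid G)"
  then show "f \<otimes>\<^bsub>EndMonoid G\<^esub> \<one>\<^bsub>EndMonoid G\<^esub> = f"
    by (auto simp: EndMonoid_def hom_def compose_def fun_eq_iff Pi_iff extensional_def)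
qed


section \<open>Groups given by generators and relations\<close>

text \<open>The letter \<open>(g, True)\<close> stands for the generator \<open>g\<close>, the letter \<open>(g, False)\<close> for its
  formal inverse.\<close>

type_synonym 'g gword = "('g \<times> bool) list"

definition gen :: "'g \<Rightarrow> 'g gword" where
  "gen g = [(g, True)]"

definition word_inv :: "'g gword \<Rightarrow> 'g gword" where
  "word_inv w = rev (map (\<lambda>(g, s). (g, \<not> s)) w)"

definition word_pow :: "'g gword \<Rightarrow> nat \<Rightarrow> 'g gword" where
  "word_pow w n = concat (replicate n w)"

definition word_comm :: "'g gword \<Rightarrow> 'g gword \<Rightarrow> 'g gword" where
  "word_comm u v = word_inv u @ word_inv v @ u @ v"

text \<open>The congruence on words generated by free cancellation together with the relations
  \<open>r = s\<close> for \<open>(r, s) \<in> R\<close>.\<close>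

inductive pres_eq :: "('g gword \<times> 'g gword) set \<Rightarrow> 'g gword \<Rightarrow> 'g gword \<Rightarrow> bool"
  for R :: "('g gword \<times> 'g gword) set" where
  refl: "pres_eq R w w"
| sym: "pres_eq R u v \<Longrightarrow> pres_eq R v u"
| trans: "pres_eq R u v \<Longrightarrow> pres_eq R v w \<Longrightarrow> pres_eq R u w"
| cancel: "pres_eq R (u @ [(g, s), (g, \<not> s)] @ v) (u @ v)"
| rel: "(r, s) \<in> R \<Longrightarrow> pres_eq R (u @ r @ v) (u @ s @ v)"

definition pres_class :: "('g gword \<times> 'g gword) set \<Rightarrow> 'g gword \<Rightarrow> 'g gword set" where
  "pres_class R w = {v. pres_eq R w v}"

definition presented_group :: "('g gword \<times> 'g gword) set \<Rightarrow> 'g gword set monoid" where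
  "presented_group R =
    \<lparr>carrier = range (pres_class R),
     monoid.mult = (\<lambda>A B. \<Union>u\<in>A. \<Union>v\<in>B. pres_class R (u @ v)),
     one = pres_class R []\<rparr>"

lemma pres_class_eq_iff: "pres_class R u = pres_class R v \<longleftrightarrow> pres_eq R u v"
  unfolding pres_class_def
  by (auto intro: pres_eq.refl dest: pres_eq.sym pres_eq.trans)

lemma pres_eq_context: "pres_eq R u v \<Longrightarrow> pres_eq R (x @ u @ y) (x @ v @ y)"
proof (induction rule: pres_eq.induct)
  case (cancel u g s v)
  show ?case using pres_eq.cancel[of R "x @ u" g s "v @ y"] by simp
next
  case (rel r s u v)
  then show ?case using pres_eq.rel[of r s R "x @ u" "v @ y"] by simp
qed (blast intro: pres_eq.intros)+

lemma pres_eq_append: "pres_eq R u u' \<Longrightarrow> pres_eq R v v' \<Longrightarrow> pres_eq R (u @ v) (u' @ v')"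
  using pres_eq_context[of R u u' "[]" v] pres_eq_context[of R v v' u' "[]"]
  by (auto intro: pres_eq.trans)

lemma pres_class_mult:
  "pres_class R u \<otimes>\<^bsub>presented_group R\<^esub> pres_class R v = pres_class R (u @ v)"
proof -
  have "pres_class R (u' @ v') = pres_class R (u @ v)"
    if "u' \<in> pres_class R u" "v' \<in> pres_class R v" for u' v'
    unfolding pres_class_eq_iff
    using that by (intro pres_eq_append) (auto simp: pres_class_def intro: pres_eq.sym)
  moreover have "u \<in> pres_class R u" "v \<in> pres_class R v"
    by (auto simp: pres_class_def intro: pres_eq.refl)
  ultimately have "(\<Union>u'\<in>pres_class R u. \<Union>v'\<in>pres_class R v. pres_class R (u' @ v'))
      = pres_class R (u @ v)" by blast
  then show ?thesis by (simp add: presented_group_def)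
qed

lemma word_inv_left: "pres_eq R (word_inv w @ w) []"
proof (induction w)
  case Nil
  show ?case by (simp add: word_inv_def pres_eq.refl)
next
  case (Cons a w)
  obtain g s where a: "a = (g, s)" by (cases a)
  have "pres_eq R (word_inv w @ [(g, \<not> s), (g, \<not> \<not> s)] @ w) (word_inv w @ w)"
    by (rule pres_eq.cancel)
  with Cons.IH show ?case
    by (auto simp: a word_inv_def intro: pres_eq.trans)
qed

lemma group_presented_group: "group (presented_group R)"
proof (rule groupI)
  show "\<one>\<^bsub>presented_group R\<^esub> \<in> carrier (presented_group R)"
    by (simp add: presented_group_def)
next
  fix x assume "x \<in> carrier (presented_group R)"
  then obtain u where u: "x = pres_class R u" by (auto simp: presented_group_def)
  have one: "\<one>\<^bsub>presented_group R\<^esub> = pres_class R []" by (simp add: presented_group_def)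
  show "\<one>\<^bsub>presented_group R\<^esub> \<otimes>\<^bsub>presented_group R\<^esub> x = x"
    by (simp add: one u pres_class_mult)
  have "pres_class R (word_inv u) \<in> carrier (presented_group R)"
    by (simp add: presented_group_def)
  moreover have "pres_class R (word_inv u) \<otimes>\<^bsub>presented_group R\<^esub> x = \<one>\<^bsub>presented_group R\<^esub>"
    by (simp add: one u pres_class_mult pres_class_eq_iff word_inv_left)
  ultimately show "\<exists>y\<in>carrier (presented_group R).
      y \<otimes>\<^bsub>presented_group R\<^esub> x = \<one>\<^bsub>presented_group R\<^esub>" by blast
next
  fix x y assume "x \<in> carrier (presented_group R)" "y \<in> carrier (presented_group R)"
  then obtain u v where "x = pres_class R u" "y = pres_class R v"
    by (auto simp: presented_group_def)
  then have "x \<otimes>\<^bsub>presented_group R\<^esub> y = pres_class R (u @ v)"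
    by (simp add: pres_class_mult)
  then show "x \<otimes>\<^bsub>presented_group R\<^esub> y \<in> carrier (presented_group R)"
    by (simp add: presented_group_def)
next
  fix x y z assume "x \<in> carrier (presented_group R)" "y \<in> carrier (presented_group R)"
    "z \<in> carrier (presented_group R)"
  then obtain u v w where "x = pres_class R u" "y = pres_class R v" "z = pres_class R w"
    by (auto simp: presented_group_def)
  then show "x \<otimes>\<^bsub>presented_group R\<^esub> y \<otimes>\<^bsub>presented_group R\<^esub> z
      = x \<otimes>\<^bsub>presented_group R\<^esub> (y \<otimes>\<^bsub>presented_group R\<^esub> z)"
    by (simp add: pres_class_mult)
qed


section \<open>The groups of Jonah and Konvisser\<close>

datatype jk_gen = A1 | A2 | B1 | B2

text \<open>The first set says that all commutators are central. In its presence the groups obtained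
  from the conventions \<open>[x, y] = x\<inverse>y\<inverse>xy\<close> and \<open>[x, y] = xyx\<inverse>y\<inverse>\<close> are the same.
  The definition makes sense for all natural numbers \<open>p\<close>, \<open>l\<^sub>1\<close>, \<open>l\<^sub>2\<close>; the JK-groups are the
  cases with \<open>p\<close> prime and \<open>(l\<^sub>1, l\<^sub>2)\<close> equal to \<open>(1, 0)\<close> or to \<open>(i, 1)\<close> with \<open>i < p\<close>.\<close>

definition jk_relations :: "nat \<Rightarrow> nat \<times> nat \<Rightarrow> (jk_gen gword \<times> jk_gen gword) set" where
  "jk_relations p l =
    {(word_comm x y @ z, z @ word_comm x y) | x y z. True} \<union>
    {(word_pow (gen A1) p, word_comm (gen A1) (gen B1)),
     (word_pow (gen A2) p,
      word_comm (gen A1) (word_pow (gen B1) (fst l) @ word_pow (gen B2) (snd l))),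
     (word_pow (gen B1) p, word_comm (gen A2) (gen B1 @ gen B2)),
     (word_pow (gen B2) p, word_comm (gen A2) (gen B2)),
     (word_comm (gen A1) (gen A2), []),
     (word_comm (gen B1) (gen B2), [])}"

definition jk_group :: "nat \<Rightarrow> nat \<times> nat \<Rightarrow> jk_gen gword set monoid" where
  "jk_group p l = presented_group (jk_relations p l)"

end

theory Submission
  imports Defs "HOL-Library.Countable" "HOL-Number_Theory.Cong"
begin

text \<open>If some \<open>w\<close> in a JK-group has \<open>w\<^sup>p = 1\<close>, then sending one generator to \<open>w\<close> and the other
  three to \<open>1\<close> defines an endomorphism, since the relations hold trivially in the abelian group
  \<open>\<langle>w\<rangle>\<close> of exponent \<open>p\<close>. If \<open>f\<close> and \<open>g\<close> are the endomorphisms obtained in this way from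
  \<open>a\<^sub>1\<close> and \<open>a\<^sub>2\<close>, then \<open>f (g a\<^sub>1) = 1\<close>, whereas \<open>g (f a\<^sub>1) = g w\<close>, which is \<open>w\<close> if \<open>a\<^sub>2\<close> has
  exponent \<open>1\<close> in \<open>w\<close>. Such elements are \<open>w = a\<^sub>1\<inverse>a\<^sub>2\<close> for \<open>\<lambda> = (1, 0)\<close>, and
  \<open>w = a\<^sub>1a\<^sub>2b\<^sub>2\<close> for \<open>p = 2\<close>, \<open>\<lambda> = (1, 1)\<close>.

  An elementary aut-abelian group that is not end-commutative is \<open>\<int> \<times> \<int>/2\<close>: its automorphisms
  are \<open>(i, b) \<mapsto> (\<plusminus>i, b + d i)\<close>, and they commute since \<open>-i \<equiv> i\<close> modulo \<open>2\<close>.\<close>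

section \<open>From endomorphisms to automorphisms, for arbitrary groups\<close>

lemma end_commutativeD:
  assumes "group G" "end_commutative G" "f \<in> hom G G" "g \<in> hom G G" "x \<in> carrier G"
  shows "f (g x) = g (f x)"
proof -
  interpret group G by fact
  \<comment> \<open>\<open>EndMonoid\<close> only contains extensional maps, so both homomorphisms
    are first restricted to the carrier.\<close>
  let ?r = "\<lambda>h. restrict h (carrier G)"
  have "?r f \<in> carrier (EndMonoid G)" "?r g \<in> carrier (EndMonoid G)"
    using assms(3,4) by (auto simp: EndMonoid_def hom_def)
  then have "compose (carrier G) (?r f) (?r g) = compose (carrier G) (?r g) (?r f)"
    using assms(2) comm_monoid.m_comm[of "EndMonoid G" "?r f" "?r g"]
    by (simp add: end_commutative_def EndMonoid_def)
  from fun_cong[OF this, of x] assms(3-5) show ?thesis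
    by (auto simp: compose_def hom_def Pi_iff)
qed

lemma end_commutative_imp_aut_abelian:
  assumes "group G" "end_commutative G"
  shows "aut_abelian G"
  unfolding aut_abelian_def
proof (rule group.group_comm_groupI)
  show "group (AutoGroup G)" by (rule group.AutoGroup[OF assms(1)])
next
  fix f g assume "f \<in> carrier (AutoGroup G)" "g \<in> carrier (AutoGroup G)"
  then have fg: "f \<in> hom G G" "g \<in> hom G G" "f \<in> Bij (carrier G)" "g \<in> Bij (carrier G)"
    by (auto simp: AutoGroup_def auto_def)
  then show "f \<otimes>\<^bsub>AutoGroup G\<^esub> g = g \<otimes>\<^bsub>AutoGroup G\<^esub> f"
    using end_commutativeD[OF assms fg(1,2)]
    by (simp add: AutoGroup_def BijGroup_def compose_def restrict_def fun_eq_iff)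
qed


section \<open>Endomorphisms of JK-groups with cyclic image\<close>

text \<open>On words, this is the homomorphism from the free group to the integers that sends
  \<open>g\<close> to 1 and the other generators to 0.\<close>

primrec exponent_sum :: "'g \<Rightarrow> 'g gword \<Rightarrow> int" where
  "exponent_sum g [] = 0"
| "exponent_sum g (x # w) =
    (if fst x = g then if snd x then 1 else - 1 else 0) + exponent_sum g w"

lemma exponent_sum_append [simp]: "exponent_sum g (u @ v) = exponent_sum g u + exponent_sum g v"
  by (induction u) auto

lemma exponent_sum_word_inv [simp]: "exponent_sum g (word_inv w) = - exponent_sum g w"
  by (induction w) (auto simp: word_inv_def)

lemma exponent_sum_word_pow [simp]: "exponent_sum g (word_pow w n) = int n * exponent_sum g w"
  by (induction n) (auto simp: word_pow_def algebra_simps)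

lemma exponent_sum_word_comm [simp]: "exponent_sum g (word_comm u v) = 0"
  by (simp add: word_comm_def)

lemma exponent_sum_gen [simp]: "exponent_sum g (gen h) = (if g = h then 1 else 0)"
  by (simp add: gen_def)

lemma pres_eq_exponent_sum_cong:
  assumes "\<And>r s. (r, s) \<in> R \<Longrightarrow> [exponent_sum g r = exponent_sum g s] (mod m)" "pres_eq R u v"
  shows "[exponent_sum g u = exponent_sum g v] (mod m)"
  using assms(2)
proof (induction rule: pres_eq.induct)
  case (rel r s u v)
  then show ?case by (simp add: cong_add assms(1))
qed (auto intro: cong_sym cong_trans)

text \<open>Commutators have exponent sum 0 and \<open>p\<close>-th powers a multiple of
  \<open>p\<close>, so the two sides of each relation agree modulo \<open>p\<close>.\<close>

lemma jk_exponent_sum_cong: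
  assumes "pres_eq (jk_relations p l) u v"
  shows "[exponent_sum g u = exponent_sum g v] (mod int p)"
  by (rule pres_eq_exponent_sum_cong[OF _ assms]) (auto simp: jk_relations_def cong_def)

lemma carrier_presented_group: "carrier (presented_group R) = range (pres_class R)"
  by (simp add: presented_group_def)

lemma pres_class_in_carrier [simp]: "pres_class R u \<in> carrier (presented_group R)"
  by (simp add: carrier_presented_group)

lemma one_presented_group: "\<one>\<^bsub>presented_group R\<^esub> = pres_class R []"
  by (simp add: presented_group_def)

lemma pres_class_word_inv: "pres_class R (word_inv u) = inv\<^bsub>presented_group R\<^esub> (pres_class R u)"
  by (rule HOL.sym, rule group.inv_equality[OF group_presented_group])
    (simp_all add: pres_class_mult one_presented_group pres_class_eq_iff word_inv_left)

lemma pres_class_word_pow: "pres_class R (word_pow u n) = pres_class R u [^]\<^bsub>presented_group R\<^esub> n"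
proof (induction n)
  case 0
  show ?case by (simp add: word_pow_def one_presented_group)
next
  case (Suc n)
  interpret group "presented_group R" by (rule group_presented_group)
  have "pres_class R (word_pow u (Suc n)) =
      pres_class R u \<otimes>\<^bsub>presented_group R\<^esub> pres_class R (word_pow u n)"
    by (simp add: word_pow_def pres_class_mult)
  also have "\<dots> = pres_class R u [^]\<^bsub>presented_group R\<^esub> Suc n"
    by (simp only: Suc nat_pow_Suc2 pres_class_in_carrier)
  finally show ?case .
qed

text \<open>A class determines exponent sums modulo \<open>p\<close>, and the order of
  \<open>cls w\<close> divides \<open>p\<close>, so the power does not depend on the representative
  \<open>u\<close>.\<close>

lemma jk_cyclic_endomorphism:
  fixes p l w
  defines "G \<equiv> jk_group p l" and "cls \<equiv> pres_class (jk_relations p l)"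
  assumes "cls (word_pow w p) = \<one>\<^bsub>G\<^esub>"
  shows "\<exists>f \<in> hom G G. \<forall>u. f (cls u) = cls w [^]\<^bsub>G\<^esub> exponent_sum g u"
proof -
  have G: "G = presented_group (jk_relations p l)" by (simp add: G_def jk_group_def)
  interpret group G unfolding G by (rule group_presented_group)
  have w [simp]: "cls u \<in> carrier G" for u by (simp add: cls_def G)
  have wp: "cls w [^]\<^bsub>G\<^esub> int p = \<one>\<^bsub>G\<^esub>"
    using assms(3) by (simp add: int_pow_int cls_def G pres_class_word_pow)
  have eq: "cls w [^]\<^bsub>G\<^esub> exponent_sum g u = cls w [^]\<^bsub>G\<^esub> exponent_sum g v"
    if uv: "cls u = cls v" for u v
  proof -
    have "[exponent_sum g u = exponent_sum g v] (mod int p)"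
      using uv by (intro jk_exponent_sum_cong) (simp add: cls_def pres_class_eq_iff)
    then obtain k where "exponent_sum g v = exponent_sum g u + int p * k"
      by (auto simp: cong_iff_lin)
    then show ?thesis by (simp add: int_pow_mult int_pow_pow[symmetric] wp)
  qed
  \<comment> \<open>The choice of a representative is harmless by \<open>eq\<close>; even outside
    the carrier the value is a power of \<open>cls w\<close>.\<close>
  define f where "f = (\<lambda>x. cls w [^]\<^bsub>G\<^esub> exponent_sum g (SOME u. x = cls u))"
  have f: "f (cls u) = cls w [^]\<^bsub>G\<^esub> exponent_sum g u" for u
    unfolding f_def by (rule eq, rule HOL.sym, rule someI) (rule HOL.refl)
  have "f \<in> hom G G"
  proof (rule homI)
    fix x y assume "x \<in> carrier G" "y \<in> carrier G"
    then obtain u v where "x = cls u" "y = cls v"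
      by (auto simp: G cls_def carrier_presented_group)
    moreover have "cls u \<otimes>\<^bsub>G\<^esub> cls v = cls (u @ v)" by (simp add: G cls_def pres_class_mult)
    ultimately show "f (x \<otimes>\<^bsub>G\<^esub> y) = f x \<otimes>\<^bsub>G\<^esub> f y" by (simp add: f int_pow_mult)
  next
    show "f x \<in> carrier G" for x by (simp add: f_def)
  qed
  with f show ?thesis by blast
qed

text \<open>The exponent sum 1 of \<open>A2\<close> acts twice: the endomorphism built from
  \<open>A2\<close> fixes the class of \<open>w\<close>, and this class is nontrivial because 1 is
  not 0 modulo \<open>p\<close>.\<close>

lemma not_end_commutative_jk_group:
  assumes p: "p > 1"
    and w: "pres_eq (jk_relations p l) (word_pow w p) []" "exponent_sum A2 w = 1"
  shows "\<not> end_commutative (jk_group p l)"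
proof
  assume ec: "end_commutative (jk_group p l)"
  let ?G = "jk_group p l" and ?cls = "pres_class (jk_relations p l)"
  have G: "?G = presented_group (jk_relations p l)" by (simp add: jk_group_def)
  interpret group ?G unfolding G by (rule group_presented_group)
  have "?cls (word_pow w p) = \<one>\<^bsub>?G\<^esub>"
    using w(1) by (simp add: G one_presented_group pres_class_eq_iff)
  note ex = jk_cyclic_endomorphism[OF this]
  obtain f where f: "f \<in> hom ?G ?G" "\<And>u. f (?cls u) = ?cls w [^]\<^bsub>?G\<^esub> exponent_sum A1 u"
    using ex by blast
  obtain g where g: "g \<in> hom ?G ?G" "\<And>u. g (?cls u) = ?cls w [^]\<^bsub>?G\<^esub> exponent_sum A2 u"
    using ex by blast
  have "f (g (?cls (gen A1))) = g (f (?cls (gen A1)))"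
    by (rule end_commutativeD[OF is_group ec f(1) g(1)]) (simp add: G)
  moreover have "?cls w \<in> carrier ?G" by (simp add: G)
  ultimately have "?cls w = \<one>\<^bsub>?G\<^esub>"
    using hom_one[OF f(1)] by (simp add: f(2) g(2) w(2) is_group)
  then have "pres_eq (jk_relations p l) w []"
    by (simp add: G one_presented_group pres_class_eq_iff)
  from jk_exponent_sum_cong[OF this, of A2] w(2) p show False
    by (simp add: cong_def)
qed


section \<open>Elements of order \<open>p\<close>\<close>

lemma (in group) commutator_eq_iff:
  assumes "x \<in> carrier G" "y \<in> carrier G" "c \<in> carrier G"
  shows "inv x \<otimes> (inv y \<otimes> (x \<otimes> y)) = c \<longleftrightarrow> x \<otimes> y = y \<otimes> (x \<otimes> c)"
  using assms by (metis inv_closed inv_solve_left m_assoc m_closed)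

text \<open>This inverse-free form lets two factors be swapped at the cost of a commutator.\<close>

lemma pres_class_word_comm:
  fixes R
  defines "G \<equiv> presented_group R" and "cls \<equiv> pres_class R"
  shows "cls u \<otimes>\<^bsub>G\<^esub> cls v = cls v \<otimes>\<^bsub>G\<^esub> (cls u \<otimes>\<^bsub>G\<^esub> cls (word_comm u v))"
proof -
  interpret group G unfolding G_def by (rule group_presented_group)
  have "inv\<^bsub>G\<^esub> cls u \<otimes>\<^bsub>G\<^esub> (inv\<^bsub>G\<^esub> cls v \<otimes>\<^bsub>G\<^esub> (cls u \<otimes>\<^bsub>G\<^esub> cls v)) = cls (word_comm u v)"
    by (simp add: G_def cls_def word_comm_def pres_class_word_inv[symmetric] pres_class_mult)
  then show ?thesis
    by (subst (asm) commutator_eq_iff) (simp_all add: G_def cls_def)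
qed

lemma jk_class_relation:
  "(r, s) \<in> jk_relations p l \<Longrightarrow> pres_class (jk_relations p l) r = pres_class (jk_relations p l) s"
  using pres_eq.rel[of r s "jk_relations p l" "[]" "[]"] by (simp add: pres_class_eq_iff)

text \<open>Here the relations read \<open>a1^p = [a1, b1] = a2^p\<close>. Since \<open>a1\<close>
  and \<open>a2\<close> commute, the \<open>p\<close>-th power distributes over
  \<open>a1^-1 a2\<close> and the factors cancel.\<close>

lemma jk_order_p_element:
  "pres_eq (jk_relations p (1, 0)) (word_pow (word_inv (gen A1) @ gen A2) p) []"
proof -
  let ?R = "jk_relations p (1, 0)"
  let ?G = "presented_group ?R" and ?cls = "pres_class (jk_relations p (1, 0))"
  interpret group ?G by (rule group_presented_group)
  let ?x = "?cls (gen A1)" and ?y = "?cls (gen A2)"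
  have "?cls (word_comm (gen A1) (gen A2)) = \<one>\<^bsub>?G\<^esub>"
    unfolding one_presented_group by (rule jk_class_relation) (simp add: jk_relations_def)
  then have comm: "?x \<otimes>\<^bsub>?G\<^esub> ?y = ?y \<otimes>\<^bsub>?G\<^esub> ?x"
    using pres_class_word_comm[of ?R "gen A1" "gen A2"] by (simp del: One_nat_def)
  have "?cls (word_pow (gen A1) p) = ?cls (word_comm (gen A1) (gen B1))"
    by (rule jk_class_relation) (simp add: jk_relations_def)
  also have "\<dots> = ?cls (word_pow (gen A2) p)"
    by (rule HOL.sym, rule jk_class_relation) (simp add: jk_relations_def word_pow_def)
  finally have pow: "?x [^]\<^bsub>?G\<^esub> p = ?y [^]\<^bsub>?G\<^esub> p" by (simp add: pres_class_word_pow)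
  have "inv\<^bsub>?G\<^esub> ?x \<otimes>\<^bsub>?G\<^esub> ?y = ?y \<otimes>\<^bsub>?G\<^esub> inv\<^bsub>?G\<^esub> ?x"
    using comm by (metis inv_closed inv_solve_left inv_solve_right m_assoc m_closed
        pres_class_in_carrier)
  then have "(inv\<^bsub>?G\<^esub> ?x \<otimes>\<^bsub>?G\<^esub> ?y) [^]\<^bsub>?G\<^esub> p = inv\<^bsub>?G\<^esub> ?x [^]\<^bsub>?G\<^esub> p \<otimes>\<^bsub>?G\<^esub> ?y [^]\<^bsub>?G\<^esub> p"
    by (rule pow_mult_distrib) (simp_all del: One_nat_def)
  also have "\<dots> = \<one>\<^bsub>?G\<^esub>" by (simp add: nat_pow_inv pow del: One_nat_def)
  finally have "(inv\<^bsub>?G\<^esub> ?x \<otimes>\<^bsub>?G\<^esub> ?y) [^]\<^bsub>?G\<^esub> p = \<one>\<^bsub>?G\<^esub>" .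
  then show ?thesis
    by (simp add: pres_class_word_inv[symmetric] pres_class_mult pres_class_word_pow[symmetric]
        one_presented_group pres_class_eq_iff)
qed

text \<open>Moving \<open>y\<close> past both factors of \<open>x \<otimes> x\<close> produces the
  central \<open>c\<close> twice, so \<open>[x^2, y] = c^2\<close>.\<close>

lemma (in group) central_commutator_square:
  assumes [simp]: "x \<in> carrier G" "y \<in> carrier G" "c \<in> carrier G"
    and xy: "x \<otimes> y = y \<otimes> (x \<otimes> c)"
    and c: "\<And>z. z \<in> carrier G \<Longrightarrow> c \<otimes> z = z \<otimes> c"
    and xx: "(x \<otimes> x) \<otimes> y = y \<otimes> (x \<otimes> x)"
  shows "c \<otimes> c = \<one>"
proof -
  have "y \<otimes> (x \<otimes> x) = x \<otimes> (x \<otimes> y)" using xx by (simp add: m_assoc)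
  also have "\<dots> = x \<otimes> (y \<otimes> (x \<otimes> c))" by (simp only: xy)
  also have "\<dots> = (x \<otimes> y) \<otimes> (x \<otimes> c)" by (simp add: m_assoc)
  also have "\<dots> = y \<otimes> (x \<otimes> (c \<otimes> x) \<otimes> c)" by (simp add: xy m_assoc)
  also have "\<dots> = (y \<otimes> (x \<otimes> x)) \<otimes> (c \<otimes> c)" by (simp add: c[of x] m_assoc)
  finally show ?thesis by simp
qed

text \<open>The squares of \<open>a1\<close>, \<open>a2\<close>, \<open>b2\<close> are
  \<open>c11\<close>, \<open>d = c12 c11\<close> and \<open>c22\<close>. Hence
  \<open>x = a1 a2\<close> satisfies \<open>x^2 = c11^2 c12 = c12\<close> and
  \<open>[x, b2] = c12 c22\<close>, so
  \<open>(x b2)^2 = x^2 b2^2 [x, b2] = c12^2 c22^2 = 1\<close>.\<close>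

lemma jk_involution:
  "pres_eq (jk_relations 2 (1, 1)) (word_pow (gen A1 @ gen A2 @ gen B2) 2) []"
proof -
  define R where "R = jk_relations 2 (1, 1)"
  define G where "G = presented_group R"
  let ?cls = "pres_class R"
  interpret group G unfolding G_def by (rule group_presented_group)
  define a1 a2 b1 b2 where ab: "a1 = ?cls (gen A1)" "a2 = ?cls (gen A2)"
    "b1 = ?cls (gen B1)" "b2 = ?cls (gen B2)"
  define c11 c12 c22 d where c: "c11 = ?cls (word_comm (gen A1) (gen B1))"
    "c12 = ?cls (word_comm (gen A1) (gen B2))" "c22 = ?cls (word_comm (gen A2) (gen B2))"
    "d = ?cls (word_comm (gen A1) (gen B1 @ gen B2))"
  have [simp]: "a1 \<in> carrier G" "a2 \<in> carrier G" "b1 \<in> carrier G" "b2 \<in> carrier G"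
    "c11 \<in> carrier G" "c12 \<in> carrier G" "c22 \<in> carrier G" "d \<in> carrier G"
    by (simp_all add: ab c G_def)
  have central: "?cls (word_comm x y) \<otimes>\<^bsub>G\<^esub> z = z \<otimes>\<^bsub>G\<^esub> ?cls (word_comm x y)"
    if z: "z \<in> carrier G" for x y z
  proof -
    from z obtain u where "z = ?cls u" by (auto simp: G_def carrier_presented_group)
    moreover have "?cls (word_comm x y @ u) = ?cls (u @ word_comm x y)"
      unfolding R_def by (rule jk_class_relation) (auto simp: jk_relations_def)
    ultimately show ?thesis by (simp add: G_def pres_class_mult)
  qed
  have cent: "c11 \<otimes>\<^bsub>G\<^esub> z = z \<otimes>\<^bsub>G\<^esub> c11" "c12 \<otimes>\<^bsub>G\<^esub> z = z \<otimes>\<^bsub>G\<^esub> c12"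
    "c22 \<otimes>\<^bsub>G\<^esub> z = z \<otimes>\<^bsub>G\<^esub> c22" "d \<otimes>\<^bsub>G\<^esub> z = z \<otimes>\<^bsub>G\<^esub> d"
    if "z \<in> carrier G" for z using central[OF that] by (simp_all add: c)
  have comm: "a1 \<otimes>\<^bsub>G\<^esub> b1 = b1 \<otimes>\<^bsub>G\<^esub> (a1 \<otimes>\<^bsub>G\<^esub> c11)" "a1 \<otimes>\<^bsub>G\<^esub> b2 = b2 \<otimes>\<^bsub>G\<^esub> (a1 \<otimes>\<^bsub>G\<^esub> c12)"
    "a2 \<otimes>\<^bsub>G\<^esub> b2 = b2 \<otimes>\<^bsub>G\<^esub> (a2 \<otimes>\<^bsub>G\<^esub> c22)"
    by (simp_all add: ab c G_def pres_class_word_comm[symmetric])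
  have d: "a1 \<otimes>\<^bsub>G\<^esub> (b1 \<otimes>\<^bsub>G\<^esub> b2) = (b1 \<otimes>\<^bsub>G\<^esub> b2) \<otimes>\<^bsub>G\<^esub> (a1 \<otimes>\<^bsub>G\<^esub> d)"
    using pres_class_word_comm[of R "gen A1" "gen B1 @ gen B2"]
    by (simp add: ab c G_def pres_class_mult)
  have "?cls (word_comm (gen A1) (gen A2)) = \<one>\<^bsub>G\<^esub>"
    unfolding G_def one_presented_group R_def
    by (rule jk_class_relation) (simp add: jk_relations_def)
  then have a12: "a1 \<otimes>\<^bsub>G\<^esub> a2 = a2 \<otimes>\<^bsub>G\<^esub> a1"
    using pres_class_word_comm[of R "gen A1" "gen A2"] 
    by (simp add: ab G_def[symmetric] flip: ab)
  have sq: "?cls (word_pow u 2) = ?cls u \<otimes>\<^bsub>G\<^esub> ?cls u" for u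
    by (simp add: word_pow_def numeral_2_eq_2 G_def pres_class_mult)
  have "?cls (word_pow (gen A1) 2) = c11"
    unfolding R_def c by (rule jk_class_relation) (simp add: jk_relations_def)
  then have a1sq: "a1 \<otimes>\<^bsub>G\<^esub> a1 = c11" by (simp add: sq ab)
  have "?cls (word_pow (gen A2) 2) = d"
    unfolding R_def c by (rule jk_class_relation) (simp add: jk_relations_def word_pow_def)
  then have a2sq: "a2 \<otimes>\<^bsub>G\<^esub> a2 = d" by (simp add: sq ab)
  have "?cls (word_pow (gen B2) 2) = c22"
    unfolding R_def c by (rule jk_class_relation) (simp add: jk_relations_def)
  then have b2sq: "b2 \<otimes>\<^bsub>G\<^esub> b2 = c22" by (simp add: sq ab)
  \<comment> \<open>The squares of \<open>a1\<close> and \<open>a2\<close> are commutators, hence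
    central.\<close>
  have "c11 \<otimes>\<^bsub>G\<^esub> c11 = \<one>\<^bsub>G\<^esub>"
    by (rule central_commutator_square[of a1 b1]) (simp_all add: comm cent a1sq)
  have "c12 \<otimes>\<^bsub>G\<^esub> c12 = \<one>\<^bsub>G\<^esub>"
    by (rule central_commutator_square[of a1 b2]) (simp_all add: comm cent a1sq)
  have "c22 \<otimes>\<^bsub>G\<^esub> c22 = \<one>\<^bsub>G\<^esub>"
    by (rule central_commutator_square[of a2 b2]) (simp_all add: comm cent a2sq)
  \<comment> \<open>Moving \<open>a1\<close> past \<open>b1 b2\<close> in one step or in two shows
    that the commutator is multiplicative in its second entry.\<close>
  have "(b1 \<otimes>\<^bsub>G\<^esub> b2) \<otimes>\<^bsub>G\<^esub> (a1 \<otimes>\<^bsub>G\<^esub> d) = b1 \<otimes>\<^bsub>G\<^esub> (a1 \<otimes>\<^bsub>G\<^esub> (c11 \<otimes>\<^bsub>G\<^esub> b2))"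
    using d comm(1) by (metis m_assoc m_closed \<open>a1 \<in> carrier G\<close> \<open>b1 \<in> carrier G\<close>
        \<open>b2 \<in> carrier G\<close> \<open>c11 \<in> carrier G\<close>)
  also have "\<dots> = b1 \<otimes>\<^bsub>G\<^esub> ((a1 \<otimes>\<^bsub>G\<^esub> b2) \<otimes>\<^bsub>G\<^esub> c11)"
    by (simp add: cent(1) m_assoc)
  also have "\<dots> = (b1 \<otimes>\<^bsub>G\<^esub> b2) \<otimes>\<^bsub>G\<^esub> (a1 \<otimes>\<^bsub>G\<^esub> (c12 \<otimes>\<^bsub>G\<^esub> c11))"
    by (simp add: comm(2) m_assoc)
  finally have dc: "d = c12 \<otimes>\<^bsub>G\<^esub> c11" by simp
  define x where "x = a1 \<otimes>\<^bsub>G\<^esub> a2"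
  have [simp]: "x \<in> carrier G" by (simp add: x_def)
  have "x \<otimes>\<^bsub>G\<^esub> x = a1 \<otimes>\<^bsub>G\<^esub> (a1 \<otimes>\<^bsub>G\<^esub> a2) \<otimes>\<^bsub>G\<^esub> a2"
    by (simp only: a12) (simp add: x_def m_assoc)
  also have "\<dots> = c11 \<otimes>\<^bsub>G\<^esub> d" by (simp add: m_assoc a1sq[symmetric] a2sq[symmetric])
  also have "\<dots> = c12 \<otimes>\<^bsub>G\<^esub> (c11 \<otimes>\<^bsub>G\<^esub> c11)" by (simp add: dc cent(2) m_assoc)
  finally have xx: "x \<otimes>\<^bsub>G\<^esub> x = c12" by (simp add: \<open>c11 \<otimes>\<^bsub>G\<^esub> c11 = \<one>\<^bsub>G\<^esub>\<close>)
  have "x \<otimes>\<^bsub>G\<^esub> b2 = a1 \<otimes>\<^bsub>G\<^esub> (b2 \<otimes>\<^bsub>G\<^esub> (a2 \<otimes>\<^bsub>G\<^esub> c22))" by (simp add: x_def m_assoc comm(3))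
  also have "\<dots> = (a1 \<otimes>\<^bsub>G\<^esub> b2) \<otimes>\<^bsub>G\<^esub> (a2 \<otimes>\<^bsub>G\<^esub> c22)" by (simp add: m_assoc)
  also have "\<dots> = b2 \<otimes>\<^bsub>G\<^esub> (a1 \<otimes>\<^bsub>G\<^esub> (c12 \<otimes>\<^bsub>G\<^esub> a2) \<otimes>\<^bsub>G\<^esub> c22)" by (simp add: comm(2) m_assoc)
  also have "\<dots> = b2 \<otimes>\<^bsub>G\<^esub> (x \<otimes>\<^bsub>G\<^esub> (c12 \<otimes>\<^bsub>G\<^esub> c22))" by (simp add: cent(2) x_def m_assoc)
  finally have xb: "x \<otimes>\<^bsub>G\<^esub> b2 = b2 \<otimes>\<^bsub>G\<^esub> (x \<otimes>\<^bsub>G\<^esub> (c12 \<otimes>\<^bsub>G\<^esub> c22))" .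
  have "(x \<otimes>\<^bsub>G\<^esub> b2) \<otimes>\<^bsub>G\<^esub> (x \<otimes>\<^bsub>G\<^esub> b2)
      = x \<otimes>\<^bsub>G\<^esub> (b2 \<otimes>\<^bsub>G\<^esub> b2) \<otimes>\<^bsub>G\<^esub> (x \<otimes>\<^bsub>G\<^esub> (c12 \<otimes>\<^bsub>G\<^esub> c22))"
    by (subst (2) xb) (simp add: m_assoc)
  also have "\<dots> = x \<otimes>\<^bsub>G\<^esub> (c22 \<otimes>\<^bsub>G\<^esub> x) \<otimes>\<^bsub>G\<^esub> (c12 \<otimes>\<^bsub>G\<^esub> c22)" by (simp add: b2sq m_assoc)
  also have "\<dots> = (x \<otimes>\<^bsub>G\<^esub> x) \<otimes>\<^bsub>G\<^esub> (c22 \<otimes>\<^bsub>G\<^esub> c12) \<otimes>\<^bsub>G\<^esub> c22"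
    by (simp add: cent(3)[of x] m_assoc)
  also have "\<dots> = (c12 \<otimes>\<^bsub>G\<^esub> c12) \<otimes>\<^bsub>G\<^esub> (c22 \<otimes>\<^bsub>G\<^esub> c22)" by (simp add: xx cent(3)[of c12] m_assoc)
  also have "\<dots> = \<one>\<^bsub>G\<^esub>"
    by (simp add: \<open>c12 \<otimes>\<^bsub>G\<^esub> c12 = \<one>\<^bsub>G\<^esub>\<close> \<open>c22 \<otimes>\<^bsub>G\<^esub> c22 = \<one>\<^bsub>G\<^esub>\<close>)
  finally have "?cls (word_pow (gen A1 @ gen A2 @ gen B2) 2) = \<one>\<^bsub>G\<^esub>"
    unfolding sq by (simp add: x_def ab G_def pres_class_mult)
  then show ?thesis
    by (simp add: G_def one_presented_group pres_class_eq_iff R_def)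
qed


section \<open>The group \<open>\<int> \<times> \<int>/2\<close>\<close>

text \<open>The group is \<open>\<int> \<times> \<int>/2\<close> transported along the injection \<open>h\<close>, so that it can live on any
  type into which \<open>\<int> \<times> \<int>/2\<close> embeds.\<close>

locale int_times_two =
  fixes h :: "int \<Rightarrow> bool \<Rightarrow> 'c" and G :: "'c monoid"
  assumes h_inj [simp]: "h i b = h j c \<longleftrightarrow> i = j \<and> b = c"
    and carrier_G: "carrier G = {h i b | i b. True}"
    and mult_G [simp]: "h i b \<otimes>\<^bsub>G\<^esub> h j c = h (i + j) (b \<noteq> c)"
    and one_G: "\<one>\<^bsub>G\<^esub> = h 0 False"
begin

lemma h_closed [simp]: "h i b \<in> carrier G"
  by (auto simp: carrier_G)

lemma group_G: "group G"
proof (rule groupI)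
  fix x assume "x \<in> carrier G"
  then obtain i b where "x = h i b" by (auto simp: carrier_G)
  then have "h (- i) b \<otimes>\<^bsub>G\<^esub> x = \<one>\<^bsub>G\<^esub>" by (simp add: one_G)
  then show "\<exists>y\<in>carrier G. y \<otimes>\<^bsub>G\<^esub> x = \<one>\<^bsub>G\<^esub>" using h_closed by blast
qed (auto simp: carrier_G one_G)

text \<open>The elements \<open>h 1 False\<close> and \<open>h 0 True\<close> generate the group.
  Inequality of truth values is addition in \<int>/2, and \<open>d \<and> odd i\<close> is the
  product \<open>d i\<close> there.\<close>

lemma hom_G_h:
  assumes f: "f \<in> hom G G" and a: "f (h 1 False) = h s d" and t: "f (h 0 True) = h 0 True"
  shows "f (h i b) = h (s * i) (b \<noteq> (d \<and> odd i))"
proof -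
  have mult: "f (h (i + j) (b \<noteq> c)) = f (h i b) \<otimes>\<^bsub>G\<^esub> f (h j c)" for i j b c
    using hom_mult[OF f, of "h i b" "h j c"] by simp
  have one: "f (h 0 False) = h 0 False"
    using hom_one[OF f group_G group_G] by (simp add: one_G)
  have int: "f (h i False) = h (s * i) (d \<and> odd i)" for i
  proof (induction i rule: int_induct[where k = 0])
    case base
    show ?case by (simp add: one)
  next
    case (step1 i)
    then show ?case using mult[of i 1 False False] by (auto simp: a algebra_simps)
  next
    case (step2 i)
    \<comment> \<open>Going down, the value at \<open>i - 1\<close> is unknown; it is solved for
      from the known values at \<open>i\<close> and 1.\<close>
    have "f (h (i - 1) False) \<in> carrier G" using f by (simp add: hom_def Pi_iff)
    then obtain j c where j: "f (h (i - 1) False) = h j c" by (auto simp: carrier_G)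
    show ?case using mult[of "i - 1" 1 False False] step2 by (auto simp: a j algebra_simps)
  qed
  show ?thesis
    using mult[of 0 i b False] by (cases b) (auto simp: t one int)
qed

text \<open>By injectivity the unique involution \<open>h 0 True\<close> is fixed; by surjectivity
  \<open>s\<close> divides 1. Only the parity of \<open>s\<close> is recorded, which suffices for
  commutation.\<close>

lemma auto_G_h:
  assumes f: "f \<in> hom G G" "bij_betw f (carrier G) (carrier G)"
  obtains s d where "odd s" "\<And>i b. f (h i b) = h (s * i) (b \<noteq> (d \<and> odd i))"
proof -
  have closed: "\<exists>j c. f (h i b) = h j c" for i b
  proof -
    have "f (h i b) \<in> carrier G" using f(1) by (simp add: hom_def Pi_iff)
    then show ?thesis by (auto simp: carrier_G)
  qed
  obtain s d where a: "f (h 1 False) = h s d" using closed by blast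
  obtain k c where t: "f (h 0 True) = h k c" using closed by blast
  have one: "f (h 0 False) = h 0 False"
    using hom_one[OF f(1) group_G group_G] by (simp add: one_G)
  have "k = 0" using hom_mult[OF f(1), of "h 0 True" "h 0 True"] by (simp add: t one)
  moreover have "f (h 0 True) \<noteq> f (h 0 False)"
    using inj_on_eq_iff[OF bij_betw_imp_inj_on[OF f(2)], of "h 0 True" "h 0 False"] by simp
  ultimately have "f (h 0 True) = h 0 True" by (simp add: t one)
  note form = hom_G_h[OF f(1) a this]
  have "h 1 False \<in> f ` carrier G" using f(2) by (simp add: bij_betw_def)
  then obtain i b where "f (h i b) = h 1 False" by (auto simp: carrier_G)
  then have "s * i = 1" by (simp add: form)
  then have "odd s" by (metis dvd_mult2 odd_one)
  with form show ?thesis using that by blast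
qed

lemma aut_abelian_G: "aut_abelian G"
  unfolding aut_abelian_def
proof (rule group.group_comm_groupI)
  show "group (AutoGroup G)" by (rule group.AutoGroup[OF group_G])
next
  fix f g assume "f \<in> carrier (AutoGroup G)" "g \<in> carrier (AutoGroup G)"
  then have fg: "f \<in> hom G G" "g \<in> hom G G" "f \<in> Bij (carrier G)" "g \<in> Bij (carrier G)"
    by (auto simp: AutoGroup_def auto_def)
  obtain s d where f: "odd s" "\<And>i b. f (h i b) = h (s * i) (b \<noteq> (d \<and> odd i))"
    by (rule auto_G_h[of f]) (use fg in \<open>auto simp: Bij_def\<close>)
  obtain s' d' where g: "odd s'" "\<And>i b. g (h i b) = h (s' * i) (b \<noteq> (d' \<and> odd i))"
    by (rule auto_G_h[of g]) (use fg in \<open>auto simp: Bij_def\<close>)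
  \<comment> \<open>As \<open>s\<close> and \<open>s'\<close> are odd, multiplying \<open>i\<close>
    by them keeps its parity, and both composites add \<open>d i + d' i\<close> in \<int>/2.\<close>
  have "f (g x) = g (f x)" if "x \<in> carrier G" for x
    using that f(1) g(1) by (auto simp: carrier_G f(2) g(2))
  then show "f \<otimes>\<^bsub>AutoGroup G\<^esub> g = g \<otimes>\<^bsub>AutoGroup G\<^esub> f"
    using fg by (simp add: AutoGroup_def BijGroup_def compose_def restrict_def fun_eq_iff)
qed

text \<open>The projection to \<open>\<int>\<close> and the reduction \<open>\<int> \<rightarrow> \<int>/2\<close> do not commute.\<close>

lemma not_end_commutative_G: "\<not> end_commutative G"
proof
  assume ec: "end_commutative G"
  define f where "f x = (THE y. \<exists>i b. x = h i b \<and> y = h i False)" for x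
  define g where "g x = (THE y. \<exists>i b. x = h i b \<and> y = h 0 (odd i))" for x
  have f: "f (h i b) = h i False" and g: "g (h i b) = h 0 (odd i)" for i b
    by (simp_all add: f_def g_def)
  have "f \<in> hom G G" "g \<in> hom G G"
    by (auto simp: hom_def carrier_G f g)
  \<comment> \<open>Here \<open>f\<close> after \<open>g\<close> gives \<open>h 0 False\<close>,
    whereas \<open>g\<close> after \<open>f\<close> gives \<open>h 0 True\<close>.\<close>
  from end_commutativeD[OF group_G ec this, of "h 1 False"] show False
    by (simp add: f g)
qed

end

lemma ex_aut_abelian_not_end_commutative:
  fixes h :: "int \<times> bool \<Rightarrow> 'c"
  assumes "inj h"
  shows "\<exists>G::'c monoid. group G \<and> aut_abelian G \<and> \<not> end_commutative G"
proof -
  define r where "r = inv_into UNIV h"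
  have [simp]: "r (h x) = x" for x
    by (simp add: r_def inv_f_f[OF assms])
  define G where "G = \<lparr>carrier = range h,
    monoid.mult = (\<lambda>x y. h (fst (r x) + fst (r y), snd (r x) \<noteq> snd (r y))),
    one = h (0, False)\<rparr>"
  interpret int_times_two "curry h" G
    by unfold_locales (auto simp: G_def inj_eq[OF assms])
  show ?thesis using group_G aut_abelian_G not_end_commutative_G by blast
qed

theorem theorem2:
  shows "(\<forall>p::nat. Factorial_Ring.prime p \<longrightarrow> \<not> end_commutative (jk_group p (1, 0)))
    \<and> \<not> end_commutative (jk_group 2 (1, 1))
    \<and> (\<forall>G::('a, 'b) monoid_scheme. group G \<longrightarrow> end_commutative G \<longrightarrow> aut_abelian G)
    \<and> (\<exists>G::jk_gen gword set monoid. group G \<and> aut_abelian G \<and> \<not> end_commutative G)"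
proof (intro conjI allI impI)
  fix p :: nat assume "Factorial_Ring.prime p"
  then have "p > 1" by (rule prime_gt_1_nat)
  then show "\<not> end_commutative (jk_group p (1, 0))"
    by (rule not_end_commutative_jk_group[OF _ jk_order_p_element]) simp
next
  show "\<not> end_commutative (jk_group 2 (1, 1))"
    by (rule not_end_commutative_jk_group[OF _ jk_involution]) simp_all
next
  fix G :: "('a, 'b) monoid_scheme" assume "group G" "end_commutative G"
  then show "aut_abelian G" by (rule end_commutative_imp_aut_abelian)
next
  \<comment> \<open>The witness has to live on the element type of the JK-groups. Pairs are coded by
    singletons of powers of \<open>A1\<close>, told apart by length; these sets are mere labels, not
    classes of a presentation.\<close>
  have "inj (\<lambda>x :: int \<times> bool. {replicate (to_nat x) (A1, True)})"
    by (rule injI) (auto simp: replicate_eq_replicate)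
  then show "\<exists>G::jk_gen gword set monoid. group G \<and> aut_abelian G \<and> \<not> end_commutative G"
    by (rule ex_aut_abelian_not_end_commutative)
qed

end
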